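(* Let $L\dashv R:\mathcal{C}\to\mathcal{X}$ and $\overline{L}\dashv\overline{R}:\mathcal{D}\to\mathcal{Y}$ be adjunctions, let $J\dashv K:\mathcal{C}\to\mathcal{D}$ and $V\dashv W:\mathcal{X}\to\mathcal{Y}$ be adjunctions, and let $(J,V,\lambda^{JV}):L\dashv R\to\overline{L}\dashv\overline{R}$ be a 1-cell in $\mathbf{Adj}_R(\mathbf{Cat})$. The following assertions are equivalent: (i) the pair $(K,W)$ extends to a 1-cell $(K,W,\lambda^{KW}):\overline{L}\dashv\overline{R}\to L\dashv R$ such that there is an adjoint object $(J,V,\lambda^{JV})\dashv(K,W,\lambda^{KW})$ in $\mathbf{Adj}_R(\mathbf{Cat})$ with unit $(\eta^{KJ},\eta^{WV})$ and counit $(\varepsilon^{JK},\varepsilon^{VW})$ given by the units and counits of $J\dashv K$ and $V\dashv W$; (ii) $\lambda^{JV}$ is invertible. In such a case, $\lambda^{KW}$ is the mate of the inverse of $\lambda^{JV}$, i.e. $\lambda^{KW}=W\overline{L}\varepsilon^{JK}\circ W(\lambda^{JV})^{-1}K\circ\eta^{WV}LK$.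
   Context: All categories are small; juxtaposition denotes composition of functors and whiskering. $L\dashv R:\mathcal{C}\to\mathcal{X}$ means $L:\mathcal{C}\to\mathcal{X}$ is left adjoint to $R$, with unit $\eta^{RL}$ and counit $\varepsilon^{LR}$; similarly for the other adjunctions. $\mathbf{Adj}_R(\mathbf{Cat})$: 0-cells are adjunctions; a 1-cell $(J,V,\lambda^{JV}):(L\dashv R:\mathcal{C}\to\mathcal{X})\to(\overline{L}\dashv\overline{R}:\mathcal{D}\to\mathcal{Y})$ consists of functors $J:\mathcal{C}\to\mathcal{D}$, $V:\mathcal{X}\to\mathcal{Y}$ and a natural transformation $\lambda^{JV}:\overline{L}J\to VL$ whose mate $\rho^{JV}=\overline{R}V\varepsilon^{LR}\circ\overline{R}\lambda^{JV}R\circ\eta^{\overline{R}\,\overline{L}}JR:JR\to\overline{R}V$ is invertible; a 2-cell $(J,V,\lambda)\to(J',V',\lambda')$ is a pair of natural transformations $(\alpha:J\to J',\beta:V\to V')$ with $\beta L\circ\lambda=\lambda'\circ\overline{L}\alpha$. The composite $(K,W,\lambda^{KW})(J,V,\lambda^{JV})$ is $(KJ,WV,W\lambda^{JV}\circ\lambda^{KW}J)$; identity 1-cells have identity $\lambda$. An adjoint object $(J,V,\lambda^{JV})\dashv(K,W,\lambda^{KW})$ in $\mathbf{Adj}_R(\mathbf{Cat})$ consists of 1-cells $(J,V,\lambda^{JV}):L\dashv R\to\overline{L}\dashv\overline{R}$, $(K,W,\lambda^{KW}):\overline{L}\dashv\overline{R}\to L\dashv R$ and 2-cells $(\eta^{KJ},\eta^{WV}):(1_{\mathcal{C}},1_{\mathcal{X}})\to(KJ,WV)$,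 $(\varepsilon^{JK},\varepsilon^{VW}):(JK,VW)\to(1_{\mathcal{D}},1_{\mathcal{Y}})$ satisfying the triangular identities componentwise. *)

theory Defs
  imports Main
begin

section \<open>Small categories, functors, natural transformations\<close>

record ('o, 'a) cat =
  Obj :: "'o set"
  Arr :: "'a set"
  Dom :: "'a \<Rightarrow> 'o"
  Cod :: "'a \<Rightarrow> 'o"
  Id :: "'o \<Rightarrow> 'a"
  Comp :: "'a \<Rightarrow> 'a \<Rightarrow> 'a"  (infixl "\<cdot>\<index>" 70)

definition hom :: "('o, 'a) cat \<Rightarrow> 'o \<Rightarrow> 'o \<Rightarrow> 'a set" where
  "hom C x y = {f \<in> Arr C. Dom C f = x \<and> Cod C f = y}"

locale category =
  fixes C :: "('o, 'a) cat" (structure)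
  assumes Dom_closed: "f \<in> Arr C \<Longrightarrow> Dom C f \<in> Obj C"
    and Cod_closed: "f \<in> Arr C \<Longrightarrow> Cod C f \<in> Obj C"
    and Id_closed: "x \<in> Obj C \<Longrightarrow> Id C x \<in> hom C x x"
    and Comp_closed: "f \<in> hom C x y \<Longrightarrow> g \<in> hom C y z \<Longrightarrow> g \<cdot> f \<in> hom C x z"
    and Comp_Id_right: "f \<in> hom C x y \<Longrightarrow> f \<cdot> Id C x = f"
    and Comp_Id_left: "f \<in> hom C x y \<Longrightarrow> Id C y \<cdot> f = f"
    and Comp_assoc: "f \<in> hom C w x \<Longrightarrow> g \<in> hom C x y \<Longrightarrow> h \<in> hom C y z \<Longrightarrow>
      (h \<cdot> g) \<cdot> f = h \<cdot> (g \<cdot> f)"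

text \<open>The values of a functor outside its source category are irrelevant; likewise for the
  components of natural transformations.\<close>

record ('o1, 'a1, 'o2, 'a2) ftor =
  on_obj :: "'o1 \<Rightarrow> 'o2"
  on_arr :: "'a1 \<Rightarrow> 'a2"

locale cat_functor = C: category C + D: category D
  for C :: "('o1, 'a1) cat" and D :: "('o2, 'a2) cat" +
  fixes F :: "('o1, 'a1, 'o2, 'a2) ftor"
  assumes on_obj_closed: "x \<in> Obj C \<Longrightarrow> on_obj F x \<in> Obj D"
    and on_arr_closed: "f \<in> hom C x y \<Longrightarrow> on_arr F f \<in> hom D (on_obj F x) (on_obj F y)"
    and on_arr_Id: "x \<in> Obj C \<Longrightarrow> on_arr F (Id C x) = Id D (on_obj F x)"
    and on_arr_Comp: "f \<in> hom C x y \<Longrightarrow> g \<in> hom C y z \<Longrightarrow>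
      on_arr F (g \<cdot>\<^bsub>C\<^esub> f) = on_arr F g \<cdot>\<^bsub>D\<^esub> on_arr F f"

definition id_ftor :: "('o, 'a, 'o, 'a) ftor" where
  "id_ftor = \<lparr>on_obj = \<lambda>x. x, on_arr = \<lambda>f. f\<rparr>"

definition comp_ftor ::
  "('o2, 'a2, 'o3, 'a3) ftor \<Rightarrow> ('o1, 'a1, 'o2, 'a2) ftor \<Rightarrow> ('o1, 'a1, 'o3, 'a3) ftor"
  (infixr "\<odot>" 80) where
  "G \<odot> F = \<lparr>on_obj = \<lambda>x. on_obj G (on_obj F x), on_arr = \<lambda>f. on_arr G (on_arr F f)\<rparr>"

locale nat_transf = F: cat_functor C D F + G: cat_functor C D G
  for C :: "('o1, 'a1) cat" and D :: "('o2, 'a2) cat"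
    and F G :: "('o1, 'a1, 'o2, 'a2) ftor" +
  fixes \<tau> :: "'o1 \<Rightarrow> 'a2"
  assumes component_closed: "x \<in> Obj C \<Longrightarrow> \<tau> x \<in> hom D (on_obj F x) (on_obj G x)"
    and naturality: "f \<in> hom C x y \<Longrightarrow>
      \<tau> y \<cdot>\<^bsub>D\<^esub> on_arr F f = on_arr G f \<cdot>\<^bsub>D\<^esub> \<tau> x"

definition nat_eq :: "('o1, 'a1) cat \<Rightarrow> ('o1 \<Rightarrow> 'a2) \<Rightarrow> ('o1 \<Rightarrow> 'a2) \<Rightarrow> bool" where
  "nat_eq C \<sigma> \<tau> \<longleftrightarrow> (\<forall>x\<in>Obj C. \<sigma> x = \<tau> x)"

definition id_nat :: "('o2, 'a2) cat \<Rightarrow> ('o1, 'a1, 'o2, 'a2) ftor \<Rightarrow> 'o1 \<Rightarrow> 'a2" where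
  "id_nat D F = (\<lambda>x. Id D (on_obj F x))"

definition vcomp :: "('o1 \<Rightarrow> 'a2) \<Rightarrow> ('o2, 'a2) cat \<Rightarrow> ('o1 \<Rightarrow> 'a2) \<Rightarrow> 'o1 \<Rightarrow> 'a2"
  ("(_ \<bullet>\<^bsub>_\<^esub> _)" [70, 0, 71] 70) where
  "\<sigma> \<bullet>\<^bsub>D\<^esub> \<tau> = (\<lambda>x. \<sigma> x \<cdot>\<^bsub>D\<^esub> \<tau> x)"

definition whisker_left :: "('o2, 'a2, 'o3, 'a3) ftor \<Rightarrow> ('o1 \<Rightarrow> 'a2) \<Rightarrow> 'o1 \<Rightarrow> 'a3"
  (infixr "\<rhd>" 75) where
  "F \<rhd> \<tau> = (\<lambda>x. on_arr F (\<tau> x))"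

definition whisker_right :: "('o2 \<Rightarrow> 'a3) \<Rightarrow> ('o1, 'a1, 'o2, 'a2) ftor \<Rightarrow> 'o1 \<Rightarrow> 'a3"
  (infixl "\<lhd>" 76) where
  "\<tau> \<lhd> F = (\<lambda>x. \<tau> (on_obj F x))"

definition nat_inverse :: "('o1, 'a1) cat \<Rightarrow> ('o2, 'a2) cat \<Rightarrow>
    ('o1, 'a1, 'o2, 'a2) ftor \<Rightarrow> ('o1, 'a1, 'o2, 'a2) ftor \<Rightarrow>
    ('o1 \<Rightarrow> 'a2) \<Rightarrow> ('o1 \<Rightarrow> 'a2) \<Rightarrow> bool" where
  "nat_inverse C D F G \<tau> \<sigma> \<longleftrightarrow>
     nat_transf C D F G \<tau> \<and> nat_transf C D G F \<sigma> \<and>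
     nat_eq C (\<sigma> \<bullet>\<^bsub>D\<^esub> \<tau>) (id_nat D F) \<and> nat_eq C (\<tau> \<bullet>\<^bsub>D\<^esub> \<sigma>) (id_nat D G)"

definition nat_invertible :: "('o1, 'a1) cat \<Rightarrow> ('o2, 'a2) cat \<Rightarrow>
    ('o1, 'a1, 'o2, 'a2) ftor \<Rightarrow> ('o1, 'a1, 'o2, 'a2) ftor \<Rightarrow> ('o1 \<Rightarrow> 'a2) \<Rightarrow> bool" where
  "nat_invertible C D F G \<tau> \<longleftrightarrow> (\<exists>\<sigma>. nat_inverse C D F G \<tau> \<sigma>)"

section \<open>Adjunctions\<close>

definition triangle_identities :: "('o1, 'a1) cat \<Rightarrow> ('o2, 'a2) cat \<Rightarrow>
    ('o1, 'a1, 'o2, 'a2) ftor \<Rightarrow> ('o2, 'a2, 'o1, 'a1) ftor \<Rightarrow>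
    ('o1 \<Rightarrow> 'a1) \<Rightarrow> ('o2 \<Rightarrow> 'a2) \<Rightarrow> bool" where
  "triangle_identities C X L R \<eta> \<epsilon> \<longleftrightarrow>
     nat_eq C ((\<epsilon> \<lhd> L) \<bullet>\<^bsub>X\<^esub> (L \<rhd> \<eta>)) (id_nat X L) \<and>
     nat_eq X ((R \<rhd> \<epsilon>) \<bullet>\<^bsub>C\<^esub> (\<eta> \<lhd> R)) (id_nat C R)"

locale adjunction = L: cat_functor C X L + R: cat_functor X C R +
  unit: nat_transf C C id_ftor "R \<odot> L" \<eta> + counit: nat_transf X X "L \<odot> R" id_ftor \<epsilon>
  for C :: "('oc, 'ac) cat" and X :: "('ox, 'ax) cat"
    and L :: "('oc, 'ac, 'ox, 'ax) ftor" and R :: "('ox, 'ax, 'oc, 'ac) ftor"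
    and \<eta> :: "'oc \<Rightarrow> 'ac" and \<epsilon> :: "'ox \<Rightarrow> 'ax" +
  assumes triangles: "triangle_identities C X L R \<eta> \<epsilon>"

section \<open>The 2-category of adjunctions whose 1-cells have an invertible right mate\<close>

record ('oc, 'ac, 'ox, 'ax) adj =
  Src :: "('oc, 'ac) cat"
  Tgt :: "('ox, 'ax) cat"
  Left :: "('oc, 'ac, 'ox, 'ax) ftor"
  Right :: "('ox, 'ax, 'oc, 'ac) ftor"
  Unit :: "'oc \<Rightarrow> 'ac"
  Counit :: "'ox \<Rightarrow> 'ax"

definition zero_cell :: "('oc, 'ac, 'ox, 'ax) adj \<Rightarrow> bool" where
  "zero_cell A \<longleftrightarrow> adjunction (Src A) (Tgt A) (Left A) (Right A) (Unit A) (Counit A)"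

record ('oc, 'ac, 'ox, 'ax, 'od, 'ad, 'oy, 'ay) adj_mor =
  Fst :: "('oc, 'ac, 'od, 'ad) ftor"
  Snd :: "('ox, 'ax, 'oy, 'ay) ftor"
  Lam :: "'oc \<Rightarrow> 'ay"

definition right_mate :: "('oc, 'ac, 'ox, 'ax) adj \<Rightarrow> ('od, 'ad, 'oy, 'ay) adj \<Rightarrow>
    ('oc, 'ac, 'ox, 'ax, 'od, 'ad, 'oy, 'ay) adj_mor \<Rightarrow> 'ox \<Rightarrow> 'ad" where
  "right_mate A B f =
     ((Right B \<odot> Snd f) \<rhd> Counit A) \<bullet>\<^bsub>Src B\<^esub>
     (Right B \<rhd> (Lam f \<lhd> Right A)) \<bullet>\<^bsub>Src B\<^esub>
     (Unit B \<lhd> (Fst f \<odot> Right A))"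

definition one_cell :: "('oc, 'ac, 'ox, 'ax) adj \<Rightarrow> ('od, 'ad, 'oy, 'ay) adj \<Rightarrow>
    ('oc, 'ac, 'ox, 'ax, 'od, 'ad, 'oy, 'ay) adj_mor \<Rightarrow> bool" where
  "one_cell A B f \<longleftrightarrow>
     zero_cell A \<and> zero_cell B \<and>
     cat_functor (Src A) (Src B) (Fst f) \<and> cat_functor (Tgt A) (Tgt B) (Snd f) \<and>
     nat_transf (Src A) (Tgt B) (Left B \<odot> Fst f) (Snd f \<odot> Left A) (Lam f) \<and>
     nat_invertible (Tgt A) (Src B) (Fst f \<odot> Right A) (Right B \<odot> Snd f) (right_mate A B f)"

definition id_one_cell :: "('oc, 'ac, 'ox, 'ax) adj \<Rightarrow>
    ('oc, 'ac, 'ox, 'ax, 'oc, 'ac, 'ox, 'ax) adj_mor" where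
  "id_one_cell A = \<lparr>Fst = id_ftor, Snd = id_ftor, Lam = id_nat (Tgt A) (Left A)\<rparr>"

text \<open>The composite \<open>g f\<close> of \<open>f : A \<rightarrow> B\<close> and \<open>g : B \<rightarrow> E\<close>; only the target 0-cell \<open>E\<close>
  is needed to form it.\<close>

definition comp_one_cell :: "('oe, 'ae, 'oz, 'az) adj \<Rightarrow>
    ('od, 'ad, 'oy, 'ay, 'oe, 'ae, 'oz, 'az) adj_mor \<Rightarrow>
    ('oc, 'ac, 'ox, 'ax, 'od, 'ad, 'oy, 'ay) adj_mor \<Rightarrow>
    ('oc, 'ac, 'ox, 'ax, 'oe, 'ae, 'oz, 'az) adj_mor" where
  "comp_one_cell E g f =
     \<lparr>Fst = Fst g \<odot> Fst f, Snd = Snd g \<odot> Snd f,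
      Lam = (Snd g \<rhd> Lam f) \<bullet>\<^bsub>Tgt E\<^esub> (Lam g \<lhd> Fst f)\<rparr>"

text \<open>To be used for \<open>f\<close>, \<open>g\<close> that are 1-cells from \<open>A\<close> to \<open>B\<close>.\<close>

definition two_cell :: "('oc, 'ac, 'ox, 'ax) adj \<Rightarrow> ('od, 'ad, 'oy, 'ay) adj \<Rightarrow>
    ('oc, 'ac, 'ox, 'ax, 'od, 'ad, 'oy, 'ay) adj_mor \<Rightarrow>
    ('oc, 'ac, 'ox, 'ax, 'od, 'ad, 'oy, 'ay) adj_mor \<Rightarrow>
    ('oc \<Rightarrow> 'ad) \<times> ('ox \<Rightarrow> 'ay) \<Rightarrow> bool" where
  "two_cell A B f g \<theta> \<longleftrightarrow>
     nat_transf (Src A) (Src B) (Fst f) (Fst g) (fst \<theta>) \<and>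
     nat_transf (Tgt A) (Tgt B) (Snd f) (Snd g) (snd \<theta>) \<and>
     nat_eq (Src A) ((snd \<theta> \<lhd> Left A) \<bullet>\<^bsub>Tgt B\<^esub> Lam f) (Lam g \<bullet>\<^bsub>Tgt B\<^esub> (Left B \<rhd> fst \<theta>))"

definition adjoint_object :: "('oc, 'ac, 'ox, 'ax) adj \<Rightarrow> ('od, 'ad, 'oy, 'ay) adj \<Rightarrow>
    ('oc, 'ac, 'ox, 'ax, 'od, 'ad, 'oy, 'ay) adj_mor \<Rightarrow>
    ('od, 'ad, 'oy, 'ay, 'oc, 'ac, 'ox, 'ax) adj_mor \<Rightarrow>
    ('oc \<Rightarrow> 'ac) \<times> ('ox \<Rightarrow> 'ax) \<Rightarrow> ('od \<Rightarrow> 'ad) \<times> ('oy \<Rightarrow> 'ay) \<Rightarrow> bool" where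
  "adjoint_object A B f g \<eta> \<epsilon> \<longleftrightarrow>
     one_cell A B f \<and> one_cell B A g \<and>
     two_cell A A (id_one_cell A) (comp_one_cell A g f) \<eta> \<and>
     two_cell B B (comp_one_cell B f g) (id_one_cell B) \<epsilon> \<and>
     triangle_identities (Src A) (Src B) (Fst f) (Fst g) (fst \<eta>) (fst \<epsilon>) \<and>
     triangle_identities (Tgt A) (Tgt B) (Snd f) (Snd g) (snd \<eta>) (snd \<epsilon>)"

end

theory Submission
  imports Defs
begin

text \<open>Write \<open>\<mu>\<close>, \<open>\<kappa>\<close> for \<open>\<lambda>\<^sup>J\<^sup>V\<close>, \<open>\<lambda>\<^sup>K\<^sup>W\<close>. If \<open>(K, W, \<kappa>)\<close> is right adjoint to \<open>(J, V, \<mu>)\<close>, the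
  2-cell conditions on unit and counit amount to saying that \<open>\<epsilon>\<^sup>V\<^sup>W L' J \<circ> V \<kappa> J \<circ> V L \<eta>\<^sup>K\<^sup>J\<close> is a
  two-sided inverse of \<open>\<mu>\<close>. Conversely, the mate \<open>\<kappa>\<close> of an inverse \<open>\<sigma>\<close> of \<open>\<mu>\<close> satisfies them, and
  its own mate \<open>K R' \<rightarrow> R W\<close> is the conjugate of \<open>\<sigma> : V L \<rightarrow> L' J\<close> for the composite adjunctions
  \<open>V L \<stileturn> R W\<close> and \<open>L' J \<stileturn> K R'\<close>, hence invertible. Given \<open>\<sigma>\<close>, the counit condition alone determines \<open>\<kappa>\<close>
  by transposition along \<open>V \<stileturn> W\<close>.\<close>

section \<open>Composition of functors and natural transformations\<close>

lemma on_obj_comp_ftor [simp]: "on_obj (G \<odot> F) x = on_obj G (on_obj F x)"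
  by (simp add: comp_ftor_def)

lemma on_arr_comp_ftor [simp]: "on_arr (G \<odot> F) f = on_arr G (on_arr F f)"
  by (simp add: comp_ftor_def)

lemma on_obj_id_ftor [simp]: "on_obj id_ftor x = x"
  by (simp add: id_ftor_def)

lemma on_arr_id_ftor [simp]: "on_arr id_ftor f = f"
  by (simp add: id_ftor_def)

lemma comp_ftor_assoc [simp]: "(H \<odot> G) \<odot> F = H \<odot> (G \<odot> F)"
  by (simp add: comp_ftor_def)

lemma comp_id_ftor [simp]: "F \<odot> id_ftor = F"
  by (simp add: comp_ftor_def id_ftor_def)

lemma id_comp_ftor [simp]: "id_ftor \<odot> F = F"
  by (simp add: comp_ftor_def id_ftor_def)

lemmas nat_simps = vcomp_def whisker_left_def whisker_right_def id_nat_def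

section \<open>Composition laws and functoriality phrased through domains and codomains\<close>

context category
begin

lemma Dom_in_Obj [simp]: "f \<in> Arr C \<Longrightarrow> Dom C f \<in> Obj C"
  and Cod_in_Obj [simp]: "f \<in> Arr C \<Longrightarrow> Cod C f \<in> Obj C"
  by (auto intro: Dom_closed Cod_closed)

lemma Id_arr [simp]:
  assumes "x \<in> Obj C"
  shows "Id C x \<in> Arr C" "Dom C (Id C x) = x" "Cod C (Id C x) = x"
  using Id_closed [OF assms] by (auto simp: hom_def)

text \<open>Together with \<open>Id_arr\<close> this lets simplification compute the type of a
  composite, which settles the composability conditions in later calculations.\<close>

lemma Comp_arr [simp]:
  assumes "f \<in> Arr C" "g \<in> Arr C" "Cod C f = Dom C g"
  shows "g \<cdot> f \<in> Arr C" "Dom C (g \<cdot> f) = Dom C f" "Cod C (g \<cdot> f) = Cod C g"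
  using Comp_closed [of f "Dom C f" "Dom C g" g "Cod C g"] assms by (auto simp: hom_def)

text \<open>The object is a free variable tied to \<open>f\<close> by an equation, so the rule also
  matches when that object appears in a computed form.\<close>

lemma Comp_Id [simp]:
  assumes "f \<in> Arr C"
  shows "x = Dom C f \<Longrightarrow> f \<cdot> Id C x = f" "x = Cod C f \<Longrightarrow> Id C x \<cdot> f = f"
  using Comp_Id_right Comp_Id_left assms by (auto simp: hom_def)

lemma assoc:
  assumes "f \<in> Arr C" "g \<in> Arr C" "h \<in> Arr C" "Cod C f = Dom C g" "Cod C g = Dom C h"
  shows "(h \<cdot> g) \<cdot> f = h \<cdot> (g \<cdot> f)"
  using Comp_assoc assms by (auto simp: hom_def)

end

context cat_functor
begin

lemmas obj [simp] = on_obj_closed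

lemma arr [simp]:
  assumes "f \<in> Arr C"
  shows "on_arr F f \<in> Arr D" "Dom D (on_arr F f) = on_obj F (Dom C f)"
    "Cod D (on_arr F f) = on_obj F (Cod C f)"
  using on_arr_closed [of f "Dom C f" "Cod C f"] assms by (auto simp: hom_def)

lemmas map_Id [simp] = on_arr_Id

lemma map_Comp [simp]:
  assumes "f \<in> Arr C" "g \<in> Arr C" "Cod C f = Dom C g"
  shows "on_arr F (g \<cdot>\<^bsub>C\<^esub> f) = on_arr F g \<cdot>\<^bsub>D\<^esub> on_arr F f"
  using on_arr_Comp assms by (auto simp: hom_def)

end

context nat_transf
begin

lemma component [simp]:
  assumes "x \<in> Obj C"
  shows "\<tau> x \<in> Arr D" "Dom D (\<tau> x) = on_obj F x" "Cod D (\<tau> x) = on_obj G x"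
  using component_closed [OF assms] by (auto simp: hom_def)

lemma natural:
  assumes "f \<in> Arr C" "Dom C f = x" "Cod C f = y"
  shows "\<tau> y \<cdot>\<^bsub>D\<^esub> on_arr F f = on_arr G f \<cdot>\<^bsub>D\<^esub> \<tau> x"
  using naturality assms by (auto simp: hom_def)

end

section \<open>Composition and whiskering, and replacement of components on objects\<close>

lemma cat_functor_comp:
  assumes "cat_functor C D F" "cat_functor D E G"
  shows "cat_functor C E (G \<odot> F)"
proof -
  interpret F: cat_functor C D F by fact
  interpret G: cat_functor D E G by fact
  show ?thesis by unfold_locales (auto simp: hom_def)
qed

lemma nat_transf_vcomp:
  assumes "nat_transf C D F G \<sigma>" "nat_transf C D G H \<tau>"
  shows "nat_transf C D F H (\<tau> \<bullet>\<^bsub>D\<^esub> \<sigma>)"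
proof -
  interpret S: nat_transf C D F G \<sigma> by fact
  interpret T: nat_transf C D G H \<tau> by fact
  have "(\<tau> y \<cdot>\<^bsub>D\<^esub> \<sigma> y) \<cdot>\<^bsub>D\<^esub> on_arr F f = on_arr H f \<cdot>\<^bsub>D\<^esub> (\<tau> x \<cdot>\<^bsub>D\<^esub> \<sigma> x)"
    if "f \<in> Arr C" "Dom C f = x" "Cod C f = y" for f x y
  proof -
    have [simp]: "x \<in> Obj C" "y \<in> Obj C" using that by auto
    have "(\<tau> y \<cdot>\<^bsub>D\<^esub> \<sigma> y) \<cdot>\<^bsub>D\<^esub> on_arr F f = \<tau> y \<cdot>\<^bsub>D\<^esub> (\<sigma> y \<cdot>\<^bsub>D\<^esub> on_arr F f)"
      using that by (simp add: S.F.D.assoc)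
    also have "\<dots> = (\<tau> y \<cdot>\<^bsub>D\<^esub> on_arr G f) \<cdot>\<^bsub>D\<^esub> \<sigma> x"
      using that by (simp add: S.natural [OF that] S.F.D.assoc)
    also have "\<dots> = on_arr H f \<cdot>\<^bsub>D\<^esub> (\<tau> x \<cdot>\<^bsub>D\<^esub> \<sigma> x)"
      using that by (simp add: T.natural [OF that] S.F.D.assoc)
    finally show ?thesis .
  qed
  then show ?thesis by unfold_locales (auto simp: hom_def nat_simps)
qed

lemma nat_transf_whisker_left:
  assumes "cat_functor D E H" "nat_transf C D F G \<tau>"
  shows "nat_transf C E (H \<odot> F) (H \<odot> G) (H \<rhd> \<tau>)"
proof -
  interpret H: cat_functor D E H by fact
  interpret T: nat_transf C D F G \<tau> by fact
  interpret HF: cat_functor C E "H \<odot> F" by (rule cat_functor_comp) unfold_locales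
  interpret HG: cat_functor C E "H \<odot> G" by (rule cat_functor_comp) unfold_locales
  have "on_arr H (\<tau> y) \<cdot>\<^bsub>E\<^esub> on_arr H (on_arr F f) = on_arr H (on_arr G f) \<cdot>\<^bsub>E\<^esub> on_arr H (\<tau> x)"
    if "f \<in> Arr C" "Dom C f = x" "Cod C f = y" for f x y
    using that T.natural [OF that] by (auto simp flip: H.map_Comp)
  then show ?thesis by unfold_locales (auto simp: hom_def nat_simps)
qed

lemma nat_transf_whisker_right:
  assumes "cat_functor B C H" "nat_transf C D F G \<tau>"
  shows "nat_transf B D (F \<odot> H) (G \<odot> H) (\<tau> \<lhd> H)"
proof -
  interpret H: cat_functor B C H by fact
  interpret T: nat_transf C D F G \<tau> by fact
  interpret FH: cat_functor B D "F \<odot> H" by (rule cat_functor_comp) unfold_locales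
  interpret GH: cat_functor B D "G \<odot> H" by (rule cat_functor_comp) unfold_locales
  show ?thesis by unfold_locales (auto simp: hom_def nat_simps T.natural)
qed

text \<open>Components outside \<open>Obj C\<close> are arbitrary, so transformations are compared
  by \<open>nat_eq\<close> and their properties have to be carried across it.\<close>

lemma nat_transf_cong:
  assumes "nat_transf C D F G \<sigma>" "nat_eq C \<sigma> \<tau>"
  shows "nat_transf C D F G \<tau>"
proof -
  interpret S: nat_transf C D F G \<sigma> by fact
  have "\<tau> x = \<sigma> x" if "x \<in> Obj C" for x
    using assms(2) that by (simp add: nat_eq_def)
  then show ?thesis by unfold_locales (auto simp: hom_def S.natural)
qed

lemma nat_invertible_cong:
  assumes "nat_inverse C D F G \<sigma> \<sigma>'" "nat_eq C \<sigma> \<tau>"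
  shows "nat_invertible C D F G \<tau>"
proof -
  have "nat_inverse C D F G \<tau> \<sigma>'"
    using assms nat_transf_cong [of C D F G \<sigma> \<tau>]
    by (auto simp: nat_inverse_def nat_eq_def nat_simps)
  then show ?thesis by (auto simp: nat_invertible_def)
qed

section \<open>Composite adjunctions and conjugate transformations\<close>

context adjunction
begin

lemma triangle_left:
  "x \<in> Obj C \<Longrightarrow> \<epsilon> (on_obj L x) \<cdot>\<^bsub>X\<^esub> on_arr L (\<eta> x) = Id X (on_obj L x)"
  using triangles by (simp add: triangle_identities_def nat_eq_def nat_simps)

lemma triangle_right:
  "x \<in> Obj X \<Longrightarrow> on_arr R (\<epsilon> x) \<cdot>\<^bsub>C\<^esub> \<eta> (on_obj R x) = Id C (on_obj R x)"
  using triangles by (simp add: triangle_identities_def nat_eq_def nat_simps)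

lemma unit_natural:
  assumes "f \<in> Arr C" "Dom C f = x" "Cod C f = y"
  shows "\<eta> y \<cdot>\<^bsub>C\<^esub> f = on_arr R (on_arr L f) \<cdot>\<^bsub>C\<^esub> \<eta> x"
  using unit.natural [OF assms] by simp

lemma counit_natural:
  assumes "f \<in> Arr X" "Dom X f = x" "Cod X f = y"
  shows "\<epsilon> y \<cdot>\<^bsub>X\<^esub> on_arr L (on_arr R f) = f \<cdot>\<^bsub>X\<^esub> \<epsilon> x"
  using counit.natural [OF assms] by simp

lemma unit_arr [simp]:
  assumes "x \<in> Obj C"
  shows "\<eta> x \<in> Arr C" "Dom C (\<eta> x) = x" "Cod C (\<eta> x) = on_obj R (on_obj L x)"
  using unit.component [OF assms] by simp_all

lemma counit_arr [simp]:
  assumes "x \<in> Obj X"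
  shows "\<epsilon> x \<in> Arr X" "Dom X (\<epsilon> x) = on_obj L (on_obj R x)" "Cod X (\<epsilon> x) = x"
  using counit.component [OF assms] by simp_all

text \<open>Half of the bijection between arrows \<open>x \<rightarrow> R y\<close> and
  \<open>L x \<rightarrow> y\<close>: naturality of \<eta> moves \<open>f\<close> outward, and a
  triangle identity removes what stands before it.\<close>

lemma transpose_left:
  assumes "f \<in> Arr C" "Dom C f = x" "Cod C f = on_obj R y" "x \<in> Obj C" "y \<in> Obj X"
  shows "on_arr R (\<epsilon> y \<cdot>\<^bsub>X\<^esub> on_arr L f) \<cdot>\<^bsub>C\<^esub> \<eta> x = f"
proof -
  have "on_arr R (\<epsilon> y \<cdot>\<^bsub>X\<^esub> on_arr L f) \<cdot>\<^bsub>C\<^esub> \<eta> x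
      = on_arr R (\<epsilon> y) \<cdot>\<^bsub>C\<^esub> (on_arr R (on_arr L f) \<cdot>\<^bsub>C\<^esub> \<eta> x)"
    using assms by (simp add: L.C.assoc)
  also have "\<dots> = (on_arr R (\<epsilon> y) \<cdot>\<^bsub>C\<^esub> \<eta> (on_obj R y)) \<cdot>\<^bsub>C\<^esub> f"
    using assms by (simp add: L.C.assoc unit_natural)
  also have "\<dots> = f"
    using assms by (simp add: triangle_right)
  finally show ?thesis .
qed

text \<open>The other half, dually, by naturality of \<epsilon>.\<close>

lemma transpose_right:
  assumes "g \<in> Arr X" "Dom X g = on_obj L x" "Cod X g = y" "x \<in> Obj C" "y \<in> Obj X"
  shows "\<epsilon> y \<cdot>\<^bsub>X\<^esub> on_arr L (on_arr R g \<cdot>\<^bsub>C\<^esub> \<eta> x) = g"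
proof -
  have "\<epsilon> y \<cdot>\<^bsub>X\<^esub> on_arr L (on_arr R g \<cdot>\<^bsub>C\<^esub> \<eta> x)
      = (\<epsilon> y \<cdot>\<^bsub>X\<^esub> on_arr L (on_arr R g)) \<cdot>\<^bsub>X\<^esub> on_arr L (\<eta> x)"
    using assms by (simp add: L.D.assoc)
  also have "\<dots> = g \<cdot>\<^bsub>X\<^esub> (\<epsilon> (on_obj L x) \<cdot>\<^bsub>X\<^esub> on_arr L (\<eta> x))"
    using assms by (simp add: L.D.assoc counit_natural)
  also have "\<dots> = g"
    using assms by (simp add: triangle_left)
  finally show ?thesis .
qed

end

text \<open>Each triangle identity of the composite reduces, by one transposition across one of the
  two adjunctions, to a triangle identity of the other.\<close>

lemma adjunction_comp:
  assumes "adjunction C X F G \<eta> \<epsilon>" "adjunction X Y F' G' \<eta>' \<epsilon>'"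
  shows "adjunction C Y (F' \<odot> F) (G \<odot> G')
    ((G \<rhd> (\<eta>' \<lhd> F)) \<bullet>\<^bsub>C\<^esub> \<eta>) (\<epsilon>' \<bullet>\<^bsub>Y\<^esub> (F' \<rhd> (\<epsilon> \<lhd> G')))"
proof -
  interpret P: adjunction C X F G \<eta> \<epsilon> by fact
  interpret Q: adjunction X Y F' G' \<eta>' \<epsilon>' by fact
  interpret F: cat_functor C Y "F' \<odot> F" by (rule cat_functor_comp) unfold_locales
  interpret G: cat_functor Y C "G \<odot> G'" by (rule cat_functor_comp) unfold_locales
  note functors = P.L.cat_functor_axioms P.R.cat_functor_axioms
    Q.L.cat_functor_axioms Q.R.cat_functor_axioms
  \<comment> \<open>The identity functor is spelled out so that the unit of the second adjunction
    can be whiskered on both sides; it is simplified away afterwards.\<close>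
  have "nat_transf C C (G \<odot> id_ftor \<odot> F) (G \<odot> (G' \<odot> F') \<odot> F) (G \<rhd> (\<eta>' \<lhd> F))"
    by (rule nat_transf_whisker_left nat_transf_whisker_right functors Q.unit.nat_transf_axioms)+
  then interpret u: nat_transf C C id_ftor "(G \<odot> G') \<odot> (F' \<odot> F)" "(G \<rhd> (\<eta>' \<lhd> F)) \<bullet>\<^bsub>C\<^esub> \<eta>"
    using nat_transf_vcomp [OF P.unit.nat_transf_axioms] by simp
  have "nat_transf Y Y (F' \<odot> (F \<odot> G) \<odot> G') (F' \<odot> id_ftor \<odot> G') (F' \<rhd> (\<epsilon> \<lhd> G'))"
    by (rule nat_transf_whisker_left nat_transf_whisker_right functors P.counit.nat_transf_axioms)+
  then interpret e: nat_transf Y Y "(F' \<odot> F) \<odot> (G \<odot> G')" id_ftor "\<epsilon>' \<bullet>\<^bsub>Y\<^esub> (F' \<rhd> (\<epsilon> \<lhd> G'))"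
    using nat_transf_vcomp [OF _ Q.counit.nat_transf_axioms] by simp
  have left: "(\<epsilon>' (on_obj F' (on_obj F x)) \<cdot>\<^bsub>Y\<^esub> on_arr F' (\<epsilon> (on_obj G' (on_obj F' (on_obj F x))))) \<cdot>\<^bsub>Y\<^esub>
      on_arr F' (on_arr F (on_arr G (\<eta>' (on_obj F x)) \<cdot>\<^bsub>C\<^esub> \<eta> x)) = Id Y (on_obj F' (on_obj F x))"
    if [simp]: "x \<in> Obj C" for x
  proof -
    have "?thesis \<longleftrightarrow> \<epsilon>' (on_obj F' (on_obj F x)) \<cdot>\<^bsub>Y\<^esub> on_arr F'
        (\<epsilon> (on_obj G' (on_obj F' (on_obj F x))) \<cdot>\<^bsub>X\<^esub> on_arr F (on_arr G (\<eta>' (on_obj F x)) \<cdot>\<^bsub>C\<^esub> \<eta> x))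
        = Id Y (on_obj F' (on_obj F x))"
      by (simp add: Q.L.D.assoc)
    also have "\<dots>"
      by (subst P.transpose_right) (simp_all add: Q.triangle_left)
    finally show ?thesis by simp
  qed
  have right: "on_arr G (on_arr G' (\<epsilon>' x \<cdot>\<^bsub>Y\<^esub> on_arr F' (\<epsilon> (on_obj G' x)))) \<cdot>\<^bsub>C\<^esub>
      (on_arr G (\<eta>' (on_obj F (on_obj G (on_obj G' x)))) \<cdot>\<^bsub>C\<^esub> \<eta> (on_obj G (on_obj G' x)))
      = Id C (on_obj G (on_obj G' x))"
    if [simp]: "x \<in> Obj Y" for x
  proof -
    have "?thesis \<longleftrightarrow> on_arr G (on_arr G' (\<epsilon>' x \<cdot>\<^bsub>Y\<^esub> on_arr F' (\<epsilon> (on_obj G' x))) \<cdot>\<^bsub>X\<^esub>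
        \<eta>' (on_obj F (on_obj G (on_obj G' x)))) \<cdot>\<^bsub>C\<^esub> \<eta> (on_obj G (on_obj G' x))
        = Id C (on_obj G (on_obj G' x))"
      by (simp add: P.L.C.assoc)
    also have "\<dots>"
      by (subst Q.transpose_left) (simp_all add: P.triangle_right)
    finally show ?thesis by simp
  qed
  \<comment> \<open>\<open>left\<close> and \<open>right\<close> apply functors to whole composites,
    so functoriality must not split these here.\<close>
  show ?thesis
    by unfold_locales (simp add: triangle_identities_def nat_eq_def nat_simps left right
      del: P.L.map_Comp P.R.map_Comp Q.L.map_Comp Q.R.map_Comp)
qed

text \<open>For \<open>\<tau> : F \<rightarrow> F'\<close> with \<open>F \<stileturn> G\<close> (unit \<open>\<eta>\<close>) and \<open>F' \<stileturn> G'\<close> (counit \<open>\<epsilon>'\<close>), this is the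
  corresponding transformation \<open>G' \<rightarrow> G\<close>.\<close>

definition conjugate where
  "conjugate C G \<eta> G' \<epsilon>' \<tau> = (G \<rhd> \<epsilon>') \<bullet>\<^bsub>C\<^esub> (G \<rhd> (\<tau> \<lhd> G')) \<bullet>\<^bsub>C\<^esub> (\<eta> \<lhd> G')"

lemma nat_transf_conjugate:
  assumes "adjunction C X F G \<eta> \<epsilon>" "adjunction C X F' G' \<eta>' \<epsilon>'" "nat_transf C X F F' \<tau>"
  shows "nat_transf X C G' G (conjugate C G \<eta> G' \<epsilon>' \<tau>)"
proof -
  interpret P: adjunction C X F G \<eta> \<epsilon> by fact
  interpret Q: adjunction C X F' G' \<eta>' \<epsilon>' by fact
  have "nat_transf X C (id_ftor \<odot> G') ((G \<odot> F) \<odot> G') (\<eta> \<lhd> G')"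
    by (rule nat_transf_whisker_right Q.R.cat_functor_axioms P.unit.nat_transf_axioms)+
  moreover have "nat_transf X C (G \<odot> F \<odot> G') (G \<odot> F' \<odot> G') (G \<rhd> (\<tau> \<lhd> G'))"
    by (rule nat_transf_whisker_left nat_transf_whisker_right
      P.R.cat_functor_axioms Q.R.cat_functor_axioms assms(3))+
  moreover have "nat_transf X C (G \<odot> F' \<odot> G') (G \<odot> id_ftor) (G \<rhd> \<epsilon>')"
    by (rule nat_transf_whisker_left P.R.cat_functor_axioms Q.counit.nat_transf_axioms)+
  ultimately show ?thesis
    unfolding conjugate_def by (auto intro: nat_transf_vcomp)
qed

text \<open>Conjugation reverses composition; this is the case where \<sigma> after \<tau> is the
  identity of \<open>F\<close>, whose conjugate is the identity of \<open>G\<close>.\<close>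

lemma conjugate_vcomp:
  assumes "adjunction C X F G \<eta> \<epsilon>" "adjunction C X F' G' \<eta>' \<epsilon>'"
    and "nat_transf C X F F' \<tau>" "nat_transf C X F' F \<sigma>"
    and "nat_eq C (\<sigma> \<bullet>\<^bsub>X\<^esub> \<tau>) (id_nat X F)"
  shows "nat_eq X (conjugate C G \<eta> G' \<epsilon>' \<tau> \<bullet>\<^bsub>C\<^esub> conjugate C G' \<eta>' G \<epsilon> \<sigma>) (id_nat C G)"
proof -
  interpret P: adjunction C X F G \<eta> \<epsilon> by fact
  interpret Q: adjunction C X F' G' \<eta>' \<epsilon>' by fact
  interpret T: nat_transf C X F F' \<tau> by fact
  interpret S: nat_transf C X F' F \<sigma> by fact
  have "conjugate C G \<eta> G' \<epsilon>' \<tau> x \<cdot>\<^bsub>C\<^esub> conjugate C G' \<eta>' G \<epsilon> \<sigma> x = Id C (on_obj G x)"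
    if [simp]: "x \<in> Obj X" for x
  proof -
    let ?g = "on_obj G x" and ?g' = "on_obj G' x"
    \<comment> \<open>\<open>k\<close> is the component at \<open>x\<close> of the conjugate of
      \<sigma>, written as the transpose of \<open>\<epsilon> x \<cdot> \<sigma> ?g\<close> across
      \<open>F' \<stileturn> G'\<close>; transposing back recovers that arrow.\<close>
    define k where "k = on_arr G' (\<epsilon> x \<cdot>\<^bsub>X\<^esub> \<sigma> ?g) \<cdot>\<^bsub>C\<^esub> \<eta>' ?g"
    have [simp]: "k \<in> Arr C" "Dom C k = ?g" "Cod C k = ?g'"
      by (simp_all add: k_def)
    have *: "\<epsilon>' x \<cdot>\<^bsub>X\<^esub> on_arr F' k = \<epsilon> x \<cdot>\<^bsub>X\<^esub> \<sigma> ?g"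
      unfolding k_def by (rule Q.transpose_right) simp_all
    have "conjugate C G \<eta> G' \<epsilon>' \<tau> x \<cdot>\<^bsub>C\<^esub> conjugate C G' \<eta>' G \<epsilon> \<sigma> x
        = on_arr G (\<epsilon>' x \<cdot>\<^bsub>X\<^esub> \<tau> ?g') \<cdot>\<^bsub>C\<^esub> (\<eta> ?g' \<cdot>\<^bsub>C\<^esub> k)"
      by (simp add: conjugate_def nat_simps k_def P.L.C.assoc)
    \<comment> \<open>Naturality of \<eta> at \<open>k\<close> brings \<open>k\<close> under
      \<open>G F\<close>; naturality of \<tau> then exchanges \<open>F k\<close> for
      \<open>F' k\<close>.\<close>
    also have "\<dots> = on_arr G (\<epsilon>' x \<cdot>\<^bsub>X\<^esub> (\<tau> ?g' \<cdot>\<^bsub>X\<^esub> on_arr F k)) \<cdot>\<^bsub>C\<^esub> \<eta> ?g"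
      by (simp add: P.unit_natural P.L.C.assoc)
    also have "\<dots> = on_arr G ((\<epsilon>' x \<cdot>\<^bsub>X\<^esub> on_arr F' k) \<cdot>\<^bsub>X\<^esub> \<tau> ?g) \<cdot>\<^bsub>C\<^esub> \<eta> ?g"
      by (simp add: T.natural P.L.D.assoc)
    also have "\<dots> = on_arr G (\<epsilon> x \<cdot>\<^bsub>X\<^esub> (\<sigma> ?g \<cdot>\<^bsub>X\<^esub> \<tau> ?g)) \<cdot>\<^bsub>C\<^esub> \<eta> ?g"
      unfolding * by (simp add: P.L.D.assoc)
    also have "\<sigma> ?g \<cdot>\<^bsub>X\<^esub> \<tau> ?g = Id X (on_obj F ?g)"
      using assms(5) by (simp add: nat_eq_def nat_simps)
    finally show ?thesis
      by (simp add: P.triangle_right)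
  qed
  then show ?thesis
    by (simp add: nat_eq_def vcomp_def id_nat_def)
qed

lemma nat_inverse_conjugate:
  assumes "adjunction C X F G \<eta> \<epsilon>" "adjunction C X F' G' \<eta>' \<epsilon>'" "nat_inverse C X F F' \<tau> \<sigma>"
  shows "nat_inverse X C G' G (conjugate C G \<eta> G' \<epsilon>' \<tau>) (conjugate C G' \<eta>' G \<epsilon> \<sigma>)"
  using assms unfolding nat_inverse_def
  by (auto intro: nat_transf_conjugate conjugate_vcomp)

section \<open>Squares of adjunctions\<close>

locale adjunction_square =
  RL: adjunction C X L R \<eta> \<epsilon> + RL': adjunction D Y L' R' \<eta>' \<epsilon>' +
  KJ: adjunction C D J K u e + WV: adjunction X Y V W v w +
  lam: nat_transf C Y "L' \<odot> J" "V \<odot> L" \<mu>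
  for C :: "('oc, 'ac) cat" and X :: "('ox, 'ax) cat"
    and L R \<eta> \<epsilon>
    and D :: "('od, 'ad) cat" and Y :: "('oy, 'ay) cat"
    and L' R' \<eta>' \<epsilon>' J K u e V W v w \<mu>
begin

lemmas functors =
  RL.L.cat_functor_axioms RL.R.cat_functor_axioms RL'.L.cat_functor_axioms RL'.R.cat_functor_axioms
  KJ.L.cat_functor_axioms KJ.R.cat_functor_axioms WV.L.cat_functor_axioms WV.R.cat_functor_axioms

text \<open>The 2-cell equation for \<open>(u, v)\<close>; its source is the identity 1-cell, whose
  identity component is already cancelled.\<close>

definition unit_compat :: "('od \<Rightarrow> 'ax) \<Rightarrow> bool" where
  "unit_compat \<kappa> \<longleftrightarrow> (\<forall>c\<in>Obj C. v (on_obj L c) =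
     on_arr W (\<mu> c) \<cdot>\<^bsub>X\<^esub> (\<kappa> (on_obj J c) \<cdot>\<^bsub>X\<^esub> on_arr L (u c)))"

text \<open>Likewise for \<open>(e, w)\<close>, where the identity 1-cell is the target.\<close>

definition counit_compat :: "('od \<Rightarrow> 'ax) \<Rightarrow> bool" where
  "counit_compat \<kappa> \<longleftrightarrow> (\<forall>d\<in>Obj D. w (on_obj L' d) \<cdot>\<^bsub>Y\<^esub> (on_arr V (\<kappa> d) \<cdot>\<^bsub>Y\<^esub> \<mu> (on_obj K d))
     = on_arr L' (e d))"

text \<open>The mate of \<open>\<sigma> : V L \<rightarrow> L' J\<close> under
  \<open>J \<stileturn> K\<close> and \<open>V \<stileturn> W\<close>; for \<sigma> inverse to \<mu>
  it is the asserted formula for \<kappa>.\<close>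

definition left_mate :: "('oc \<Rightarrow> 'ay) \<Rightarrow> 'od \<Rightarrow> 'ax" where
  "left_mate \<sigma> = ((W \<odot> L') \<rhd> e) \<bullet>\<^bsub>X\<^esub> (W \<rhd> (\<sigma> \<lhd> K)) \<bullet>\<^bsub>X\<^esub> (v \<lhd> (L \<odot> K))"

lemma lam_arr [simp]:
  assumes "c \<in> Obj C"
  shows "\<mu> c \<in> Arr Y" "Dom Y (\<mu> c) = on_obj L' (on_obj J c)" "Cod Y (\<mu> c) = on_obj V (on_obj L c)"
  using lam.component [OF assms] by simp_all

section \<open>From the compatibility equations to an inverse of \<mu>\<close>

lemma nat_invertible_if_compat:
  assumes "nat_transf D X (L \<odot> K) (W \<odot> L') \<kappa>" "unit_compat \<kappa>" "counit_compat \<kappa>"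
  shows "nat_invertible C Y (L' \<odot> J) (V \<odot> L) \<mu>"
proof -
  interpret k: nat_transf D X "L \<odot> K" "W \<odot> L'" \<kappa> by fact
  have [simp]: "\<kappa> d \<in> Arr X" "Dom X (\<kappa> d) = on_obj L (on_obj K d)"
    "Cod X (\<kappa> d) = on_obj W (on_obj L' d)" if "d \<in> Obj D" for d
    using k.component [OF that] by simp_all
  \<comment> \<open>The mate of \<kappa> in the direction opposite to \<open>left_mate\<close>: the
    candidate inverse of \<mu>.\<close>
  define \<sigma> where "\<sigma> = (w \<lhd> (L' \<odot> J)) \<bullet>\<^bsub>Y\<^esub> (V \<rhd> (\<kappa> \<lhd> J)) \<bullet>\<^bsub>Y\<^esub> ((V \<odot> L) \<rhd> u)"
  have VL: "cat_functor C Y (V \<odot> L)" and LJ: "cat_functor C Y (L' \<odot> J)"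
    by (rule cat_functor_comp functors)+
  have "nat_transf C Y ((V \<odot> L) \<odot> id_ftor) ((V \<odot> L) \<odot> K \<odot> J) ((V \<odot> L) \<rhd> u)"
    by (rule nat_transf_whisker_left VL KJ.unit.nat_transf_axioms)+
  moreover have "nat_transf C Y (V \<odot> (L \<odot> K) \<odot> J) (V \<odot> (W \<odot> L') \<odot> J) (V \<rhd> (\<kappa> \<lhd> J))"
    by (rule nat_transf_whisker_left nat_transf_whisker_right functors assms(1))+
  moreover have "nat_transf C Y ((V \<odot> W) \<odot> (L' \<odot> J)) (id_ftor \<odot> (L' \<odot> J)) (w \<lhd> (L' \<odot> J))"
    by (rule nat_transf_whisker_right LJ WV.counit.nat_transf_axioms)+
  ultimately have "nat_transf C Y (V \<odot> L) (L' \<odot> J) \<sigma>"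
    unfolding \<sigma>_def by (auto intro: nat_transf_vcomp)
  moreover have "\<sigma> c \<cdot>\<^bsub>Y\<^esub> \<mu> c = Id Y (on_obj L' (on_obj J c))" if [simp]: "c \<in> Obj C" for c
  proof -
    let ?Jc = "on_obj J c"
    have "\<sigma> c \<cdot>\<^bsub>Y\<^esub> \<mu> c = w (on_obj L' ?Jc) \<cdot>\<^bsub>Y\<^esub> (on_arr V (\<kappa> ?Jc) \<cdot>\<^bsub>Y\<^esub> (on_arr (V \<odot> L) (u c) \<cdot>\<^bsub>Y\<^esub> \<mu> c))"
      by (simp add: \<sigma>_def nat_simps RL'.L.D.assoc)
    \<comment> \<open>Naturality of \<mu> at \<open>u c\<close> moves \<mu> to the object
      \<open>K J c\<close>, where the counit equation at \<open>J c\<close> applies and leaves a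
      triangle of \<open>J \<stileturn> K\<close>.\<close>
    also have "\<dots> = (w (on_obj L' ?Jc) \<cdot>\<^bsub>Y\<^esub> (on_arr V (\<kappa> ?Jc) \<cdot>\<^bsub>Y\<^esub> \<mu> (on_obj K ?Jc))) \<cdot>\<^bsub>Y\<^esub> on_arr L' (on_arr J (u c))"
      by (simp add: lam.natural [of "u c", symmetric] RL'.L.D.assoc
          del: on_arr_comp_ftor) (simp add: RL'.L.D.assoc)
    also have "\<dots> = on_arr L' (e ?Jc \<cdot>\<^bsub>D\<^esub> on_arr J (u c))"
      using assms(3) by (simp add: counit_compat_def)
    finally show ?thesis
      by (simp add: KJ.triangle_left del: RL'.L.map_Comp)
  qed
  moreover have "\<mu> c \<cdot>\<^bsub>Y\<^esub> \<sigma> c = Id Y (on_obj V (on_obj L c))" if [simp]: "c \<in> Obj C" for c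
  proof -
    let ?Jc = "on_obj J c"
    have "\<mu> c \<cdot>\<^bsub>Y\<^esub> \<sigma> c = (\<mu> c \<cdot>\<^bsub>Y\<^esub> w (on_obj L' ?Jc)) \<cdot>\<^bsub>Y\<^esub> on_arr V (\<kappa> ?Jc \<cdot>\<^bsub>X\<^esub> on_arr L (u c))"
      by (simp add: \<sigma>_def nat_simps RL'.L.D.assoc)
    \<comment> \<open>Naturality of \<open>w\<close> at \<open>\<mu> c\<close> makes the unit
      equation applicable under \<open>V\<close>, leaving a triangle of
      \<open>V \<stileturn> W\<close>.\<close>
    also have "\<dots> = w (on_obj V (on_obj L c)) \<cdot>\<^bsub>Y\<^esub>
        on_arr V (on_arr W (\<mu> c) \<cdot>\<^bsub>X\<^esub> (\<kappa> ?Jc \<cdot>\<^bsub>X\<^esub> on_arr L (u c)))"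
      by (simp add: WV.counit_natural [symmetric] RL'.L.D.assoc)
    also have "\<dots> = w (on_obj V (on_obj L c)) \<cdot>\<^bsub>Y\<^esub> on_arr V (v (on_obj L c))"
      using assms(2) by (simp add: unit_compat_def)
    finally show ?thesis
      by (simp add: WV.triangle_left)
  qed
  ultimately have "nat_inverse C Y (L' \<odot> J) (V \<odot> L) \<mu> \<sigma>"
    by (simp add: nat_inverse_def nat_eq_def vcomp_def id_nat_def lam.nat_transf_axioms)
  then show ?thesis by (auto simp: nat_invertible_def)
qed

section \<open>From an inverse \<sigma> of \<mu> to the 1-cell structure on the right
  adjoints\<close>

context
  fixes \<sigma>
  assumes inverse: "nat_inverse C Y (L' \<odot> J) (V \<odot> L) \<mu> \<sigma>"
begin

lemma sigma_nat: "nat_transf C Y (V \<odot> L) (L' \<odot> J) \<sigma>"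
  using inverse by (simp add: nat_inverse_def)

interpretation s: nat_transf C Y "V \<odot> L" "L' \<odot> J" \<sigma>
  by (rule sigma_nat)

lemma sigma_arr [simp]:
  assumes "c \<in> Obj C"
  shows "\<sigma> c \<in> Arr Y" "Dom Y (\<sigma> c) = on_obj V (on_obj L c)" "Cod Y (\<sigma> c) = on_obj L' (on_obj J c)"
  using s.component [OF assms] by simp_all

lemma sigma_lam: "c \<in> Obj C \<Longrightarrow> \<sigma> c \<cdot>\<^bsub>Y\<^esub> \<mu> c = Id Y (on_obj L' (on_obj J c))"
  and lam_sigma: "c \<in> Obj C \<Longrightarrow> \<mu> c \<cdot>\<^bsub>Y\<^esub> \<sigma> c = Id Y (on_obj V (on_obj L c))"
  using inverse by (simp_all add: nat_inverse_def nat_eq_def vcomp_def id_nat_def)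

text \<open>Exhibits the mate at \<open>d\<close> as the transpose across
  \<open>V \<stileturn> W\<close> of a single arrow of \<open>Y\<close>, the form on which the
  transposition lemmas act.\<close>

lemma left_mate_eq:
  assumes "d \<in> Obj D"
  shows "left_mate \<sigma> d = on_arr W (on_arr L' (e d) \<cdot>\<^bsub>Y\<^esub> \<sigma> (on_obj K d)) \<cdot>\<^bsub>X\<^esub> v (on_obj L (on_obj K d))"
  using assms by (simp add: left_mate_def nat_simps)

lemma nat_transf_left_mate: "nat_transf D X (L \<odot> K) (W \<odot> L') (left_mate \<sigma>)"
proof -
  have LK: "cat_functor D X (L \<odot> K)" and WL: "cat_functor D X (W \<odot> L')"
    by (rule cat_functor_comp functors)+
  have "nat_transf D X (id_ftor \<odot> (L \<odot> K)) ((W \<odot> V) \<odot> (L \<odot> K)) (v \<lhd> (L \<odot> K))"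
    by (rule nat_transf_whisker_right LK WV.unit.nat_transf_axioms)+
  moreover have "nat_transf D X (W \<odot> (V \<odot> L) \<odot> K) (W \<odot> (L' \<odot> J) \<odot> K) (W \<rhd> (\<sigma> \<lhd> K))"
    by (rule nat_transf_whisker_left nat_transf_whisker_right functors sigma_nat)+
  moreover have "nat_transf D X ((W \<odot> L') \<odot> (J \<odot> K)) ((W \<odot> L') \<odot> id_ftor) ((W \<odot> L') \<rhd> e)"
    by (rule nat_transf_whisker_left WL KJ.counit.nat_transf_axioms)+
  ultimately show ?thesis
    unfolding left_mate_def by (auto intro: nat_transf_vcomp)
qed

text \<open>Naturality of \<open>v\<close> at \<open>L (u c)\<close> gathers everything else under
  \<open>W\<close>; there \<sigma> is followed by \<mu> and cancels.\<close>

lemma unit_compat_left_mate: "unit_compat (left_mate \<sigma>)"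
  unfolding unit_compat_def
proof
  fix c assume [simp]: "c \<in> Obj C"
  let ?Jc = "on_obj J c" and ?Lc = "on_obj L c"
  \<comment> \<open>The arrow whose transpose is the mate at \<open>J c\<close>. Naturality of
    \<sigma> at \<open>u c\<close> and a triangle of \<open>J \<stileturn> K\<close> reduce
    \<open>?h\<close> after \<open>V L (u c)\<close> to \<open>\<sigma> c\<close>.\<close>
  let ?h = "on_arr L' (e ?Jc) \<cdot>\<^bsub>Y\<^esub> \<sigma> (on_obj K ?Jc)"
  have "?h \<cdot>\<^bsub>Y\<^esub> on_arr V (on_arr L (u c))
      = on_arr L' (e ?Jc) \<cdot>\<^bsub>Y\<^esub> (on_arr L' (on_arr J (u c)) \<cdot>\<^bsub>Y\<^esub> \<sigma> c)"
    using s.natural [of "u c"] by (simp add: RL'.L.D.assoc)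
  also have "\<dots> = on_arr L' (e ?Jc \<cdot>\<^bsub>D\<^esub> on_arr J (u c)) \<cdot>\<^bsub>Y\<^esub> \<sigma> c"
    by (simp add: RL'.L.D.assoc)
  also have "\<dots> = \<sigma> c"
    by (simp add: KJ.triangle_left del: RL'.L.map_Comp)
  finally have *: "?h \<cdot>\<^bsub>Y\<^esub> on_arr V (on_arr L (u c)) = \<sigma> c" .
  have "on_arr W (\<mu> c) \<cdot>\<^bsub>X\<^esub> (left_mate \<sigma> ?Jc \<cdot>\<^bsub>X\<^esub> on_arr L (u c))
      = on_arr W (\<mu> c) \<cdot>\<^bsub>X\<^esub> (on_arr W ?h \<cdot>\<^bsub>X\<^esub> (v (on_obj L (on_obj K ?Jc)) \<cdot>\<^bsub>X\<^esub> on_arr L (u c)))"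
    by (simp add: left_mate_eq RL.L.D.assoc)
  also have "\<dots> = on_arr W (\<mu> c \<cdot>\<^bsub>Y\<^esub> (?h \<cdot>\<^bsub>Y\<^esub> on_arr V (on_arr L (u c)))) \<cdot>\<^bsub>X\<^esub> v ?Lc"
    by (simp add: WV.unit_natural RL.L.D.assoc)
  also have "\<dots> = v ?Lc"
    unfolding * by (simp add: lam_sigma del: WV.R.map_Comp)
  finally show "v ?Lc = on_arr W (\<mu> c) \<cdot>\<^bsub>X\<^esub> (left_mate \<sigma> ?Jc \<cdot>\<^bsub>X\<^esub> on_arr L (u c))" ..
qed

text \<open>Transposing the mate back gives \<open>L' (e d)\<close> after \<sigma>, and this
  \<sigma> cancels the \<mu> on its right.\<close>

lemma counit_compat_left_mate: "counit_compat (left_mate \<sigma>)"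
  unfolding counit_compat_def
proof
  fix d assume [simp]: "d \<in> Obj D"
  let ?h = "on_arr L' (e d) \<cdot>\<^bsub>Y\<^esub> \<sigma> (on_obj K d)"
  have [simp]: "left_mate \<sigma> d \<in> Arr X" "Dom X (left_mate \<sigma> d) = on_obj L (on_obj K d)"
    "Cod X (left_mate \<sigma> d) = on_obj W (on_obj L' d)"
    by (simp_all add: left_mate_eq)
  have *: "w (on_obj L' d) \<cdot>\<^bsub>Y\<^esub> on_arr V (left_mate \<sigma> d) = ?h"
    unfolding left_mate_eq [OF \<open>d \<in> Obj D\<close>] by (rule WV.transpose_right) simp_all
  have "w (on_obj L' d) \<cdot>\<^bsub>Y\<^esub> (on_arr V (left_mate \<sigma> d) \<cdot>\<^bsub>Y\<^esub> \<mu> (on_obj K d))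
      = (w (on_obj L' d) \<cdot>\<^bsub>Y\<^esub> on_arr V (left_mate \<sigma> d)) \<cdot>\<^bsub>Y\<^esub> \<mu> (on_obj K d)"
    by (simp add: RL'.L.D.assoc)
  also have "\<dots> = on_arr L' (e d)"
    unfolding * by (simp add: sigma_lam RL'.L.D.assoc)
  finally show "w (on_obj L' d) \<cdot>\<^bsub>Y\<^esub> (on_arr V (left_mate \<sigma> d) \<cdot>\<^bsub>Y\<^esub> \<mu> (on_obj K d)) = on_arr L' (e d)" .
qed

text \<open>Composing the counit equation with \<sigma> on the right cancels \<mu>, so \<kappa> and
  the mate have the same transpose across \<open>V \<stileturn> W\<close>.\<close>

lemma counit_compat_unique:
  assumes "nat_transf D X (L \<odot> K) (W \<odot> L') \<kappa>" "counit_compat \<kappa>"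
  shows "nat_eq D \<kappa> (left_mate \<sigma>)"
  unfolding nat_eq_def
proof
  interpret k: nat_transf D X "L \<odot> K" "W \<odot> L'" \<kappa> by fact
  fix d assume d [simp]: "d \<in> Obj D"
  have [simp]: "\<kappa> d \<in> Arr X" "Dom X (\<kappa> d) = on_obj L (on_obj K d)"
    "Cod X (\<kappa> d) = on_obj W (on_obj L' d)"
    using k.component [OF d] by simp_all
  have "on_arr L' (e d) \<cdot>\<^bsub>Y\<^esub> \<sigma> (on_obj K d)
      = (w (on_obj L' d) \<cdot>\<^bsub>Y\<^esub> (on_arr V (\<kappa> d) \<cdot>\<^bsub>Y\<^esub> \<mu> (on_obj K d))) \<cdot>\<^bsub>Y\<^esub> \<sigma> (on_obj K d)"
    using assms(2) by (simp add: counit_compat_def)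
  also have "\<dots> = w (on_obj L' d) \<cdot>\<^bsub>Y\<^esub> on_arr V (\<kappa> d)"
    by (simp add: RL'.L.D.assoc lam_sigma)
  finally have "left_mate \<sigma> d
      = on_arr W (w (on_obj L' d) \<cdot>\<^bsub>Y\<^esub> on_arr V (\<kappa> d)) \<cdot>\<^bsub>X\<^esub> v (on_obj L (on_obj K d))"
    by (simp add: left_mate_eq del: WV.R.map_Comp)
  also have "\<dots> = \<kappa> d"
    by (rule WV.transpose_left) simp_all
  finally show "\<kappa> d = left_mate \<sigma> d" ..
qed

text \<open>On objects, \<rho> is the conjugate of \<sigma> for the two composite adjunctions:
  unfolding their units and counits yields the same composite. Conjugation preserves
  invertibility.\<close>

lemma nat_invertible_right_mate:
  assumes "nat_eq Y \<rho> (((R \<odot> W) \<rhd> \<epsilon>') \<bullet>\<^bsub>C\<^esub> (R \<rhd> (left_mate \<sigma> \<lhd> R')) \<bullet>\<^bsub>C\<^esub> (\<eta> \<lhd> (K \<odot> R')))"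
  shows "nat_invertible Y C (K \<odot> R') (R \<odot> W) \<rho>"
proof -
  \<comment> \<open>The roles are exchanged since \<sigma> is the transformation to be conjugated;
    the conjugate of \<mu> then inverts \<rho>.\<close>
  have "nat_inverse C Y (V \<odot> L) (L' \<odot> J) \<sigma> \<mu>"
    using inverse by (simp add: nat_inverse_def)
  note inv = nat_inverse_conjugate
    [OF adjunction_comp [OF RL.adjunction_axioms WV.adjunction_axioms]
        adjunction_comp [OF KJ.adjunction_axioms RL'.adjunction_axioms] this]
  show ?thesis
    by (rule nat_invertible_cong [OF inv])
      (use assms in \<open>simp add: nat_eq_def conjugate_def nat_simps left_mate_eq RL.L.C.assoc\<close>)
qed

end

end

section \<open>Translation between cells of the 2-category and equations in the square\<close>

theorem proposition2p1p2:
  fixes C :: "('oc, 'ac) cat" and X :: "('ox, 'ax) cat"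
    and D :: "('od, 'ad) cat" and Y :: "('oy, 'ay) cat"
    and L :: "('oc, 'ac, 'ox, 'ax) ftor" and R :: "('ox, 'ax, 'oc, 'ac) ftor"
    and L' :: "('od, 'ad, 'oy, 'ay) ftor" and R' :: "('oy, 'ay, 'od, 'ad) ftor"
    and J :: "('oc, 'ac, 'od, 'ad) ftor" and K :: "('od, 'ad, 'oc, 'ac) ftor"
    and V :: "('ox, 'ax, 'oy, 'ay) ftor" and W :: "('oy, 'ay, 'ox, 'ax) ftor"
    and \<eta>RL :: "'oc \<Rightarrow> 'ac" and \<epsilon>LR :: "'ox \<Rightarrow> 'ax"
    and \<eta>RL' :: "'od \<Rightarrow> 'ad" and \<epsilon>LR' :: "'oy \<Rightarrow> 'ay"
    and \<eta>KJ :: "'oc \<Rightarrow> 'ac" and \<epsilon>JK :: "'od \<Rightarrow> 'ad"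
    and \<eta>WV :: "'ox \<Rightarrow> 'ax" and \<epsilon>VW :: "'oy \<Rightarrow> 'ay"
    and lam_JV :: "'oc \<Rightarrow> 'ay"
    and A :: "('oc, 'ac, 'ox, 'ax) adj" and B :: "('od, 'ad, 'oy, 'ay) adj"
  assumes "adjunction C X L R \<eta>RL \<epsilon>LR"
    and "adjunction D Y L' R' \<eta>RL' \<epsilon>LR'"
    and "adjunction C D J K \<eta>KJ \<epsilon>JK"
    and "adjunction X Y V W \<eta>WV \<epsilon>VW"
    and "A = \<lparr>Src = C, Tgt = X, Left = L, Right = R, Unit = \<eta>RL, Counit = \<epsilon>LR\<rparr>"
    and "B = \<lparr>Src = D, Tgt = Y, Left = L', Right = R', Unit = \<eta>RL', Counit = \<epsilon>LR'\<rparr>"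
    and "one_cell A B \<lparr>Fst = J, Snd = V, Lam = lam_JV\<rparr>"
  shows "((\<exists>lam_KW. adjoint_object A B \<lparr>Fst = J, Snd = V, Lam = lam_JV\<rparr> \<lparr>Fst = K, Snd = W, Lam = lam_KW\<rparr>
             (\<eta>KJ, \<eta>WV) (\<epsilon>JK, \<epsilon>VW))
          \<longleftrightarrow> nat_invertible C Y (L' \<odot> J) (V \<odot> L) lam_JV)
    \<and> (\<forall>lam_KW lam_JV_inv.
         adjoint_object A B \<lparr>Fst = J, Snd = V, Lam = lam_JV\<rparr> \<lparr>Fst = K, Snd = W, Lam = lam_KW\<rparr>
           (\<eta>KJ, \<eta>WV) (\<epsilon>JK, \<epsilon>VW)
         \<and> nat_inverse C Y (L' \<odot> J) (V \<odot> L) lam_JV lam_JV_inv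
         \<longrightarrow> nat_eq D lam_KW
              (((W \<odot> L') \<rhd> \<epsilon>JK) \<bullet>\<^bsub>X\<^esub> (W \<rhd> (lam_JV_inv \<lhd> K)) \<bullet>\<^bsub>X\<^esub> (\<eta>WV \<lhd> (L \<odot> K))))"
proof -
  let ?f = "\<lparr>Fst = J, Snd = V, Lam = lam_JV\<rparr>"
  have lam: "nat_transf C Y (L' \<odot> J) (V \<odot> L) lam_JV"
    using assms(5,6,7) by (simp add: one_cell_def)
  interpret adjunction_square C X L R \<eta>RL \<epsilon>LR D Y L' R' \<eta>RL' \<epsilon>LR' J K \<eta>KJ \<epsilon>JK V W \<eta>WV \<epsilon>VW lam_JV
    using assms(1-4) lam by (simp add: adjunction_square_def)
  \<comment> \<open>This is \<open>right_mate\<close> of \<open>(K, W, \<kappa>)\<close> as a 1-cell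
    from \<open>B\<close> to \<open>A\<close>, with the records unfolded.\<close>
  define mate where "mate \<kappa> = ((R \<odot> W) \<rhd> \<epsilon>LR') \<bullet>\<^bsub>C\<^esub> (R \<rhd> (\<kappa> \<lhd> R')) \<bullet>\<^bsub>C\<^esub> (\<eta>RL \<lhd> (K \<odot> R'))"
    for \<kappa> :: "'od \<Rightarrow> 'ax"
  \<comment> \<open>The remaining conjuncts of \<open>adjoint_object\<close> hold already:
    \<open>?f\<close> is a 1-cell, and the triangle identities come from
    \<open>J \<stileturn> K\<close> and \<open>V \<stileturn> W\<close>.\<close>
  have adj: "adjoint_object A B ?f \<lparr>Fst = K, Snd = W, Lam = \<kappa>\<rparr> (\<eta>KJ, \<eta>WV) (\<epsilon>JK, \<epsilon>VW) \<longleftrightarrow>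
      nat_transf D X (L \<odot> K) (W \<odot> L') \<kappa> \<and> nat_invertible Y C (K \<odot> R') (R \<odot> W) (mate \<kappa>) \<and>
      unit_compat \<kappa> \<and> counit_compat \<kappa>"
    (is "?adj \<kappa> \<longleftrightarrow> ?cell \<kappa> \<and> ?inv \<kappa> \<and> _") for \<kappa>
  \<comment> \<open>Naturality of \<kappa> supplies the types of its components for rebracketing the
    2-cell equations; when it fails, both sides are false.\<close>
  proof (cases "?cell \<kappa>")
    case True
    then interpret k: nat_transf D X "L \<odot> K" "W \<odot> L'" \<kappa> .
    have [simp]: "\<kappa> d \<in> Arr X" "Dom X (\<kappa> d) = on_obj L (on_obj K d)"
      "Cod X (\<kappa> d) = on_obj W (on_obj L' d)" if "d \<in> Obj D" for d
      using k.component [OF that] by simp_all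
    have "one_cell B A \<lparr>Fst = K, Snd = W, Lam = \<kappa>\<rparr> \<longleftrightarrow> ?inv \<kappa>"
      using assms(1-6) True functors
      by (simp add: one_cell_def zero_cell_def right_mate_def mate_def)
    moreover have "two_cell A A (id_one_cell A) (comp_one_cell A \<lparr>Fst = K, Snd = W, Lam = \<kappa>\<rparr> ?f) (\<eta>KJ, \<eta>WV)
        \<longleftrightarrow> unit_compat \<kappa>"
      using KJ.unit.nat_transf_axioms WV.unit.nat_transf_axioms
      by (simp add: two_cell_def id_one_cell_def comp_one_cell_def assms(5) unit_compat_def
        nat_eq_def nat_simps RL.L.D.assoc)
    moreover have "two_cell B B (comp_one_cell B ?f \<lparr>Fst = K, Snd = W, Lam = \<kappa>\<rparr>) (id_one_cell B) (\<epsilon>JK, \<epsilon>VW)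
        \<longleftrightarrow> counit_compat \<kappa>"
      using KJ.counit.nat_transf_axioms WV.counit.nat_transf_axioms
      by (simp add: two_cell_def id_one_cell_def comp_one_cell_def assms(6) counit_compat_def
        nat_eq_def nat_simps)
    ultimately show ?thesis
      using True assms(5-7) KJ.triangles WV.triangles by (simp add: adjoint_object_def)
  next
    case False
    then show ?thesis
      using assms(5,6) by (simp add: adjoint_object_def one_cell_def)
  qed
  \<comment> \<open>The witness for (i) is the mate of the given inverse.\<close>
  have exists: "?adj (left_mate \<sigma>)" if "nat_inverse C Y (L' \<odot> J) (V \<odot> L) lam_JV \<sigma>" for \<sigma>
    unfolding adj
    using that nat_transf_left_mate unit_compat_left_mate counit_compat_left_mate
      nat_invertible_right_mate [OF that, of "mate (left_mate \<sigma>)"]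
    by (simp add: mate_def nat_eq_def)
  show ?thesis
  proof (intro conjI allI impI iffI)
    assume "\<exists>\<kappa>. ?adj \<kappa>"
    then show "nat_invertible C Y (L' \<odot> J) (V \<odot> L) lam_JV"
      unfolding adj using nat_invertible_if_compat by blast
  next
    assume "nat_invertible C Y (L' \<odot> J) (V \<odot> L) lam_JV"
    then show "\<exists>\<kappa>. ?adj \<kappa>"
      unfolding nat_invertible_def using exists by blast
  next
    fix \<kappa> \<sigma>
    assume "?adj \<kappa> \<and> nat_inverse C Y (L' \<odot> J) (V \<odot> L) lam_JV \<sigma>"
    then have "nat_eq D \<kappa> (left_mate \<sigma>)"
      unfolding adj using counit_compat_unique by blast
    then show "nat_eq D \<kappa> (((W \<odot> L') \<rhd> \<epsilon>JK) \<bullet>\<^bsub>X\<^esub> (W \<rhd> (\<sigma> \<lhd> K)) \<bullet>\<^bsub>X\<^esub> (\<eta>WV \<lhd> (L \<odot> K)))"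
      by (simp only: left_mate_def)
  qed
qed

end
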